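(* Let $\Gamma$ be a (valued) tree and let $\hat\Gamma$ be the tree obtained from $\Gamma$ by adding one new vertex and joining it to $\Gamma$ by exactly one (possibly weighted) edge. For a tree $\Gamma$ let $\varphi_1(\Gamma)$ denote the dominant (maximal) eigenvalue of $DF(\Gamma)$, equivalently of $FD(\Gamma)$. Then: 1) The dominant eigenvalue may only grow: $\varphi_1(\hat\Gamma)\ge\varphi_1(\Gamma)$. 2) If $\Gamma$ is an extended Dynkin diagram (i.e. $\mathcal B\ge0$), then the spectra of $DF(\hat\Gamma)$ and $FD(\hat\Gamma)$ do not contain $1$. 3) If the Tits form $\mathcal B$ is indefinite, then $\varphi_1(\hat\Gamma)>1$.
   Context: A valued tree has generalized Cartan matrix $K$ ($k_{ii}=2$, $k_{ij}$ nonpositive integers for $i\ne j$, $k_{ij}=0\iff k_{ji}=0$), which is symmetrizable: $K=T{\bf B}$, $T$ positive diagonal, ${\bf B}$ symmetric; $\mathcal B$ is the quadratic (Tits) form of $\Gamma$ with matrix ${\bf B}$. Splitting the vertices into two classes such that every edge joins the two classes, write $K=\begin{pmatrix}2I&2D\\2F&2I\end{pmatrix}$; in the simply-laced case $F=D^t$, so $DF=DD^t$ and $FD=D^tD$. The matrices $DF$ and $FD$ are nonnegative and irreducible and have a common simple positive maximal eigenvalue, called the dominant eigenvalue. *)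

theory Defs
  imports "Jordan_Normal_Form.Spectral_Radius"
begin

definition generalized_cartan_matrix :: "int mat \<Rightarrow> bool" where
  "generalized_cartan_matrix K \<longleftrightarrow>
     square_mat K \<and>
     (\<forall>i < dim_row K. K $$ (i, i) = 2) \<and>
     (\<forall>i < dim_row K. \<forall>j < dim_row K. i \<noteq> j \<longrightarrow>
        K $$ (i, j) \<le> 0 \<and> (K $$ (i, j) = 0 \<longleftrightarrow> K $$ (j, i) = 0))"

definition symmetrization :: "int mat \<Rightarrow> real mat \<Rightarrow> real mat \<Rightarrow> bool" where
  "symmetrization K T B \<longleftrightarrow>
     T \<in> carrier_mat (dim_row K) (dim_row K) \<and> diagonal_mat T \<and>
     (\<forall>i < dim_row K. T $$ (i, i) > 0) \<and>
     B \<in> carrier_mat (dim_row K) (dim_row K) \<and> transpose_mat B = B \<and>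
     map_mat real_of_int K = T * B"

definition adjacent :: "int mat \<Rightarrow> nat \<Rightarrow> nat \<Rightarrow> bool" where
  "adjacent K i j \<longleftrightarrow> i < dim_row K \<and> j < dim_row K \<and> i \<noteq> j \<and> K $$ (i, j) \<noteq> 0"

text \<open>An undirected tree: a nonempty connected graph without cycles. The adjacency relation is
  meant to be symmetric and irreflexive, so a cycle is a closed list of at least three
  distinct vertices. (The predicate \<open>tree\<close> of the Graph Theory entry excludes directed
  cycles, hence also the two-cycles of a symmetric digraph, and is not usable here.)\<close>

definition tree_graph :: "'a set \<Rightarrow> ('a \<Rightarrow> 'a \<Rightarrow> bool) \<Rightarrow> bool" where
  "tree_graph V E \<longleftrightarrow>
     V \<noteq> {} \<and> (\<forall>u \<in> V. \<forall>v \<in> V. E\<^sup>*\<^sup>* u v) \<and>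
     \<not> (\<exists>c. 3 \<le> length c \<and> distinct c \<and> set c \<subseteq> V \<and>
          successively E c \<and> E (last c) (hd c))"

definition valued_tree :: "int mat \<Rightarrow> bool" where
  "valued_tree K \<longleftrightarrow>
     generalized_cartan_matrix K \<and> tree_graph {..<dim_row K} (adjacent K) \<and>
     (\<exists>T B. symmetrization K T B)"

text \<open>The map \<open>f\<close> embeds the vertices of the small graph into those of the large one and \<open>w\<close> is
  the new vertex. The two numberings are otherwise unrelated, because each of them has to list
  the vertices of one bipartition class before those of the other.\<close>

definition one_vertex_extension :: "int mat \<Rightarrow> int mat \<Rightarrow> bool" where
  "one_vertex_extension K K' \<longleftrightarrow>
     dim_row K' = Suc (dim_row K) \<and>
     (\<exists>f w. w < dim_row K' \<and> bij_betw f {..<dim_row K} ({..<dim_row K'} - {w}) \<and>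
        (\<forall>i < dim_row K. \<forall>j < dim_row K. K' $$ (f i, f j) = K $$ (i, j)) \<and>
        (\<exists>!i. i < dim_row K \<and> adjacent K' w (f i)))"

text \<open>The diagonal blocks force every edge to join the two classes, the first \<open>p\<close> vertices and the
  last \<open>q\<close> vertices. One of the classes is empty if the tree has a single vertex.\<close>

definition bipartite_splitting ::
  "int mat \<Rightarrow> nat \<Rightarrow> nat \<Rightarrow> real mat \<Rightarrow> real mat \<Rightarrow> bool" where
  "bipartite_splitting K p q D F \<longleftrightarrow>
     D \<in> carrier_mat p q \<and> F \<in> carrier_mat q p \<and>
     map_mat real_of_int K =
       four_block_mat (2 \<cdot>\<^sub>m 1\<^sub>m p) (2 \<cdot>\<^sub>m D) (2 \<cdot>\<^sub>m F) (2 \<cdot>\<^sub>m 1\<^sub>m q)"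

definition tits_form :: "real mat \<Rightarrow> real vec \<Rightarrow> real" where
  "tits_form B x = x \<bullet> (B *\<^sub>v x)"

definition positive_definite :: "real mat \<Rightarrow> bool" where
  "positive_definite B \<longleftrightarrow>
     (\<forall>x \<in> carrier_vec (dim_row B). x \<noteq> 0\<^sub>v (dim_row B) \<longrightarrow> tits_form B x > 0)"

definition nonnegative_definite :: "real mat \<Rightarrow> bool" where
  "nonnegative_definite B \<longleftrightarrow> (\<forall>x \<in> carrier_vec (dim_row B). tits_form B x \<ge> 0)"

definition indefinite :: "real mat \<Rightarrow> bool" where
  "indefinite B \<longleftrightarrow>
     (\<exists>x \<in> carrier_vec (dim_row B). tits_form B x > 0) \<and>
     (\<exists>x \<in> carrier_vec (dim_row B). tits_form B x < 0)"

text \<open>The positive definite forms belong to the Dynkin diagrams, so the condition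
  \<open>B \<ge> 0\<close> characterizing the extended Dynkin diagrams excludes them.\<close>

definition extended_dynkin :: "real mat \<Rightarrow> bool" where
  "extended_dynkin B \<longleftrightarrow> nonnegative_definite B \<and> \<not> positive_definite B"

definition complex_spectrum :: "real mat \<Rightarrow> complex set" where
  "complex_spectrum A = spectrum (map_mat complex_of_real A)"

definition dominant_eigenvalue :: "real mat \<Rightarrow> real \<Rightarrow> bool" where
  "dominant_eigenvalue A \<mu> \<longleftrightarrow>
     complex_of_real \<mu> \<in> complex_spectrum A \<and> (\<forall>z \<in> complex_spectrum A. cmod z \<le> \<mu>)"

text \<open>The common maximal eigenvalue of \<open>D F\<close> and \<open>F D\<close>. For a single vertex one of the two
  products is the matrix of dimension 0, which has no eigenvalues, and the other one alone
  determines the value.\<close>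

definition dominant_value :: "nat \<Rightarrow> nat \<Rightarrow> real mat \<Rightarrow> real mat \<Rightarrow> real \<Rightarrow> bool" where
  "dominant_value p q D F \<phi> \<longleftrightarrow>
     (p > 0 \<or> q > 0) \<and>
     (p > 0 \<longrightarrow> dominant_eigenvalue (D * F) \<phi>) \<and> (q > 0 \<longrightarrow> dominant_eigenvalue (F * D) \<phi>)"

end

theory Submission
  imports Defs "HOL-Analysis.Function_Topology"
begin

text \<open>
  Write \<open>K = 2 I - 2 N\<close>. The matrix \<open>N\<close> is nonnegative with zero diagonal, and the weights
  \<open>g i = 1 / T $$ (i, i)\<close> make it self-adjoint for the inner product
  \<open>\<Sum>i. g i * x i * y i\<close>; in these terms the Tits form is twice the difference of
  \<open>\<langle>x, x\<rangle>\<close> and \<open>\<langle>x, N x\<rangle>\<close>. Let \<open>\<mu>\<close> be the maximum of the Rayleigh quotient of \<open>N\<close>. It exists by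
  compactness, it is attained at an eigenvector, and since \<open>N\<close> is nonnegative, replacing a
  complex eigenvector by its entrywise modulus shows that \<open>\<mu>\<close> bounds the modulus of every complex
  eigenvalue.

  For a bipartite numbering \<open>N\<close> has the off-diagonal blocks \<open>- D\<close> and \<open>- F\<close>, so for \<open>w \<noteq> 0\<close> the
  number \<open>w\<^sup>2\<close> is an eigenvalue of \<open>D F\<close> (equivalently of \<open>F D\<close>) exactly if \<open>w\<close> is an eigenvalue
  of \<open>N\<close>. Hence the dominant eigenvalue is \<open>\<mu>\<^sup>2\<close>, and the three claims become statements on \<open>N\<close>:

  \<^item> Growth. A maximal eigenvector of the small tree, extended by zero to the new vertex,
  satisfies the eigenvector equation on the old vertices, so its Rayleigh quotient is \<open>\<mu>\<close> for every
  choice of positive weights, in particular for those that symmetrize the large tree.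

  \<^item> Extended Dynkin diagrams. The eigenvalue 1 of \<open>D' F'\<close> means \<open>N' x = x\<close>, that is \<open>K' x = 0\<close>.
  By nonnegativity of the form and connectedness, no nonzero null vector of the small form has a
  zero coordinate. Pairing the rows of \<open>K' x = 0\<close> that belong to old vertices
  with a null vector \<open>z\<close> forces \<open>x\<close> to vanish at the new vertex. The remaining coordinates then form a
  null vector of the small form, and the row of the new vertex says that it vanishes at the
  neighbour of the new vertex, so it is zero.

  \<^item> Indefinite forms. A vector with negative Tits form has Rayleigh quotient above 1, so
  \<open>\<mu> > 1\<close>, and growth transfers this to the larger tree.
\<close>

section \<open>Nonnegative self-adjoint operators on a weighted finite set\<close>

text \<open>
  The operator with matrix \<open>a\<close> on \<open>n\<close> coordinates is self-adjoint for the inner product with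
  weights \<open>g\<close>. Vectors are functions on all natural numbers whose values beyond \<open>n\<close> are
  ignored, so that restricting to a subgraph and extending by zero need no change of type.
\<close>

locale weighted_graph =
  fixes n :: nat and a :: "nat \<Rightarrow> nat \<Rightarrow> real" and g :: "nat \<Rightarrow> real"
  assumes weight_pos: "i < n \<Longrightarrow> g i > 0"
    and entry_nonneg: "i < n \<Longrightarrow> j < n \<Longrightarrow> a i j \<ge> 0"
    and loop_free: "i < n \<Longrightarrow> a i i = 0"
    and balanced: "i < n \<Longrightarrow> j < n \<Longrightarrow> g i * a i j = g j * a j i"
begin

definition act :: "(nat \<Rightarrow> real) \<Rightarrow> nat \<Rightarrow> real" where
  "act x i = (\<Sum>j<n. a i j * x j)"

definition pairing :: "(nat \<Rightarrow> real) \<Rightarrow> (nat \<Rightarrow> real) \<Rightarrow> real" where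
  "pairing x y = (\<Sum>i<n. g i * x i * y i)"

lemma pairing_commute: "pairing x y = pairing y x"
  by (simp add: pairing_def mult_ac)

lemma pairing_linear:
  "pairing x (\<lambda>i. c * y i + d * z i) = c * pairing x y + d * pairing x z"
  by (simp add: pairing_def sum_distrib_left sum.distrib algebra_simps)

lemma pairing_linear_left:
  "pairing (\<lambda>i. c * y i + d * z i) x = c * pairing y x + d * pairing z x"
  by (simp add: pairing_def sum_distrib_left sum.distrib algebra_simps)

lemma act_linear: "act (\<lambda>i. c * x i + d * y i) = (\<lambda>i. c * act x i + d * act y i)"
  by (simp add: act_def fun_eq_iff sum_distrib_left sum.distrib algebra_simps)

lemma pairing_act_commute: "pairing x (act y) = pairing (act x) y"
proof -
  have "pairing x (act y) = (\<Sum>i<n. \<Sum>j<n. g i * a i j * x i * y j)"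
    by (simp add: pairing_def act_def sum_distrib_left mult_ac)
  also have "\<dots> = (\<Sum>j<n. \<Sum>i<n. g i * a i j * x i * y j)"
    by (rule sum.swap)
  also have "\<dots> = (\<Sum>j<n. \<Sum>i<n. g j * a j i * x i * y j)"
    by (intro sum.cong refl) (use balanced in auto)
  also have "\<dots> = pairing (act x) y"
    by (simp add: pairing_def act_def sum_distrib_left sum_distrib_right mult_ac)
  finally show ?thesis .
qed

lemma pairing_self_nonneg: "pairing x x \<ge> 0"
  unfolding pairing_def using weight_pos by (intro sum_nonneg) (simp add: mult.assoc less_imp_le)

lemma pairing_self_pos:
  assumes "i < n" "x i \<noteq> 0"
  shows "pairing x x > 0"
  unfolding pairing_def
proof (rule sum_pos2)
  have "0 < x i * x i" using assms not_real_square_gt_zero by blast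
  then show "0 < g i * x i * x i"
    using assms weight_pos by (simp add: mult.assoc)
  show "0 \<le> g j * x j * x j" if "j \<in> {..<n}" for j
    using that weight_pos by (simp add: mult.assoc less_imp_le)
qed (use assms in auto)

lemma pairing_self_eq_0D: "pairing x x = 0 \<Longrightarrow> i < n \<Longrightarrow> x i = 0"
  using pairing_self_pos by force

lemma pairing_unit:
  assumes "i < n"
  shows "pairing (\<lambda>j. of_bool (j = i)) y = g i * y i"
proof -
  have "pairing (\<lambda>j. of_bool (j = i)) y = (\<Sum>j<n. if j = i then g i * y i else 0)"
    unfolding pairing_def by (intro sum.cong) auto
  then show ?thesis using assms by simp
qed

lemma pairing_cong:
  "(\<And>i. i < n \<Longrightarrow> x i = x' i) \<Longrightarrow> (\<And>i. i < n \<Longrightarrow> y i = y' i) \<Longrightarrow> pairing x y = pairing x' y'"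
  unfolding pairing_def by (intro sum.cong) auto

lemma act_cong: "(\<And>i. i < n \<Longrightarrow> x i = x' i) \<Longrightarrow> act x = act x'"
  unfolding act_def by (intro ext sum.cong) auto

text \<open>
  The form \<open>\<mu> * \<langle>y, y\<rangle> - \<langle>y, N y\<rangle>\<close> is nonnegative and vanishes at \<open>z\<close>, so its derivative at \<open>z\<close>
  in each coordinate direction vanishes. With \<open>\<mu>\<close> the maximal Rayleigh quotient this produces an
  eigenvector; with \<open>\<mu> = 1\<close> it says that isotropic vectors of a nonnegative Tits form lie in its
  radical.
\<close>

lemma maximizer_is_eigenvector:
  assumes bound: "\<And>y. pairing y (act y) \<le> \<mu> * pairing y y"
    and attained: "pairing z (act z) \<ge> \<mu> * pairing z z"
    and "i < n"
  shows "act z i = \<mu> * z i"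
proof -
  define e where "e = (\<lambda>j. of_bool (j = i) :: real)"
  define b where "b = g i * (\<mu> * z i - act z i)"
  define c where "c = \<mu> * pairing e e - pairing e (act e)"
  have nonneg: "2 * s * b + s\<^sup>2 * c \<ge> 0" for s :: real
  proof -
    define y where "y = (\<lambda>j. 1 * z j + s * e j)"
    have "pairing y y = pairing z z + 2 * s * pairing e z + s\<^sup>2 * pairing e e"
      unfolding y_def pairing_linear pairing_linear_left
      by (simp add: pairing_commute[of z e] algebra_simps power2_eq_square)
    moreover have "pairing y (act y) = pairing z (act z) + 2 * s * pairing e (act z) + s\<^sup>2 * pairing e (act e)"
      unfolding y_def act_linear pairing_linear pairing_linear_left
      by (simp add: pairing_act_commute[of z e] pairing_commute[of "act z" e] algebra_simps power2_eq_square)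
    moreover have b: "b = \<mu> * pairing e z - pairing e (act z)"
      using \<open>i < n\<close> by (simp add: b_def e_def pairing_unit algebra_simps)
    ultimately have "2 * s * b + s\<^sup>2 * c = (\<mu> * pairing y y - pairing y (act y)) + (pairing z (act z) - \<mu> * pairing z z)"
      unfolding b by (simp add: c_def algebra_simps)
    then show ?thesis using bound[of y] attained by simp
  qed
  have "b = 0"
  proof (rule ccontr)
    assume "b \<noteq> 0"
    \<comment> \<open>\<open>2 * s * b + s\<^sup>2 * c\<close> has the slope \<open>2 * b\<close> at \<open>s = 0\<close>; this step against the slope is
      short enough for the linear term to win, whatever the sign of \<open>c\<close>.\<close>
    define d where "d = \<bar>c\<bar> + 1"
    define s where "s = - b / d"
    have d: "d > 0" "c - 2 * d < 0" by (simp_all add: d_def abs_if)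
    have "2 * s * b + s\<^sup>2 * c = (b\<^sup>2 / d\<^sup>2) * (c - 2 * d)"
      using d(1) by (simp add: s_def field_simps power2_eq_square)
    moreover have "(b\<^sup>2 / d\<^sup>2) * (c - 2 * d) < 0"
      using \<open>b \<noteq> 0\<close> d by (intro mult_pos_neg) auto
    ultimately show False using nonneg[of s] by simp
  qed
  then show ?thesis using weight_pos[OF \<open>i < n\<close>] by (simp add: b_def)
qed

text \<open>
  The Rayleigh quotient attains its maximum \<open>\<mu>\<close> on the unit sphere, which is compact in the
  product topology as a closed subset of a box. Since the diagonal of \<open>a\<close> is zero, a unit coordinate vector has
  Rayleigh quotient 0, whence \<open>\<mu> \<ge> 0\<close>.
\<close>

lemma dominant_pair_exists:
  assumes "n > 0"
  obtains \<mu> i x where "\<mu> \<ge> 0" "i < n" "x i \<noteq> 0" "\<And>i. i < n \<Longrightarrow> act x i = \<mu> * x i"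
    "\<And>y. pairing y (act y) \<le> \<mu> * pairing y y"
proof -
  define S where "S = {x. (\<forall>i\<ge>n. x i = 0) \<and> pairing x x = 1}"
  define box where "box = PiE UNIV (\<lambda>i. if i < n then {- (1 / sqrt (g i)) .. 1 / sqrt (g i)} else {0})"
  have "compactin (product_topology (\<lambda>_. euclidean) UNIV) box"
    unfolding box_def compactin_PiE by auto
  then have "compact box"
    by (simp add: euclidean_product_topology)
  moreover have cont: "continuous_on A (\<lambda>x. x i)" for A :: "(nat \<Rightarrow> real) set" and i
    by (rule continuous_on_subset[OF continuous_on_product_coordinates]) auto
  have "closed S"
  proof -
    have "S = (\<Inter>i\<in>{n..}. {x. x i = 0}) \<inter> {x. pairing x x = 1}"
      by (auto simp: S_def)
    moreover have "closed {x::nat \<Rightarrow> real. x i = 0}" for i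
      by (intro closed_Collect_eq cont) auto
    moreover have "closed {x. pairing x x = 1}"
      unfolding pairing_def by (intro closed_Collect_eq continuous_intros cont)
    ultimately show ?thesis by (auto intro!: closed_INT)
  qed
  moreover have "S \<subseteq> box"
  proof
    fix x assume "x \<in> S"
    have "x i \<in> {- (1 / sqrt (g i)) .. 1 / sqrt (g i)}" if "i < n" for i
    proof -
      have "g i * x i * x i \<le> pairing x x"
        unfolding pairing_def using that weight_pos
        by (intro member_le_sum) (auto simp: mult.assoc less_imp_le)
      then have "g i * (x i)\<^sup>2 \<le> 1" using \<open>x \<in> S\<close> by (simp add: S_def power2_eq_square mult.assoc)
      then have "(x i)\<^sup>2 \<le> 1 / g i" using weight_pos[OF that] by (simp add: field_simps)
      then have "\<bar>x i\<bar> \<le> sqrt (1 / g i)" by (metis real_sqrt_abs real_sqrt_le_iff)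
      then show ?thesis by (auto simp: real_sqrt_divide abs_le_iff)
    qed
    then show "x \<in> box" using \<open>x \<in> S\<close> by (auto simp: box_def S_def)
  qed
  ultimately have "compact S"
    by (metis compact_Int_closed inf.absorb_iff2)
  have normalise: "(\<lambda>i. if i < n then y i / sqrt (pairing y y) else 0) \<in> S" if "pairing y y > 0" for y
  proof -
    have "pairing (\<lambda>i. if i < n then y i / sqrt (pairing y y) else 0)
            (\<lambda>i. if i < n then y i / sqrt (pairing y y) else 0)
        = (\<Sum>i<n. g i * y i * y i / pairing y y)"
      unfolding pairing_def[of "\<lambda>i. if i < n then _ i else _"]
      by (intro sum.cong refl) (use that in \<open>simp add: field_simps\<close>)
    also have "\<dots> = 1"
      using that by (simp add: pairing_def flip: sum_divide_distrib)
    finally show ?thesis by (simp add: S_def)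
  qed
  have "pairing (\<lambda>j. of_bool (j = 0)) (\<lambda>j. of_bool (j = 0)) > 0"
    using assms by (intro pairing_self_pos[of 0]) auto
  then have "S \<noteq> {}" using normalise by blast
  moreover have "continuous_on S (\<lambda>x. pairing x (act x))"
    unfolding pairing_def act_def by (intro continuous_intros cont)
  ultimately obtain z where z: "z \<in> S" and max: "\<And>y. y \<in> S \<Longrightarrow> pairing y (act y) \<le> pairing z (act z)"
    using continuous_attains_sup[OF \<open>compact S\<close>] by blast
  define \<mu> where "\<mu> = pairing z (act z)"
  have bound: "pairing y (act y) \<le> \<mu> * pairing y y" for y
  proof (cases "pairing y y = 0")
    case True
    then have "pairing y (act y) = 0"
      by (auto simp: pairing_def[of y "act y"] dest: pairing_self_eq_0D intro!: sum.neutral)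
    then show ?thesis using True by simp
  next
    case False
    then have pos: "pairing y y > 0" using pairing_self_nonneg[of y] by simp
    define c where "c = 1 / sqrt (pairing y y)"
    define u where "u = (\<lambda>i. if i < n then y i / sqrt (pairing y y) else 0)"
    have "act u = act (\<lambda>i. c * y i + 0 * y i)"
      by (rule act_cong) (simp add: u_def c_def)
    then have "pairing u (act u) = pairing (\<lambda>i. c * y i + 0 * y i) (\<lambda>i. c * act y i + 0 * act y i)"
      unfolding act_linear by (intro pairing_cong) (simp_all add: u_def c_def)
    also have "\<dots> = c\<^sup>2 * pairing y (act y)"
      unfolding pairing_linear pairing_linear_left by (simp add: power2_eq_square)
    also have "c\<^sup>2 = 1 / pairing y y"
      using pos by (simp add: c_def power_divide)
    finally have "pairing y (act y) / pairing y y \<le> \<mu>"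
      using max[OF normalise[OF pos]] by (simp add: u_def \<mu>_def)
    then show ?thesis using pos by (simp add: field_simps)
  qed
  have eig: "act z i = \<mu> * z i" if "i < n" for i
    using bound z that by (intro maximizer_is_eigenvector) (auto simp: \<mu>_def S_def)
  have "\<exists>i<n. z i \<noteq> 0"
  proof (rule ccontr)
    assume "\<not> ?thesis"
    then have "pairing z z = 0" by (auto simp: pairing_def intro!: sum.neutral)
    then show False using z by (simp add: S_def)
  qed
  then obtain i where i: "i < n" "z i \<noteq> 0" by blast
  have "\<mu> \<ge> 0"
  proof -
    let ?e = "\<lambda>j. of_bool (j = (0::nat)) :: real"
    have "act ?e 0 = (\<Sum>j<n. if j = 0 then a 0 0 else 0)"
      unfolding act_def by (intro sum.cong) auto
    then have "pairing ?e (act ?e) = 0"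
      using assms loop_free[of 0] by (simp add: pairing_unit)
    moreover have "pairing ?e ?e > 0"
      using assms by (intro pairing_self_pos[of 0]) auto
    ultimately show ?thesis using bound[of ?e] by (simp add: zero_le_mult_iff)
  qed
  then show ?thesis using that i eig bound by blast
qed

lemma act_abs_ge:
  fixes z :: "nat \<Rightarrow> complex"
  assumes "i < n"
  shows "cmod (\<Sum>j<n. of_real (a i j) * z j) \<le> act (\<lambda>j. cmod (z j)) i"
proof -
  have "cmod (\<Sum>j<n. of_real (a i j) * z j) \<le> (\<Sum>j<n. cmod (of_real (a i j) * z j))"
    by (rule norm_sum)
  also have "\<dots> = act (\<lambda>j. cmod (z j)) i"
    unfolding act_def using assms entry_nonneg by (intro sum.cong) (auto simp: norm_mult)
  finally show ?thesis .
qed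

text \<open>
  If \<open>N z = w z\<close> then \<open>\<bar>w\<bar> \<bar>z\<bar> \<le> N \<bar>z\<bar>\<close> entrywise, so the real vector \<open>\<bar>z\<bar>\<close> has Rayleigh quotient
  at least \<open>\<bar>w\<bar>\<close>.
\<close>

lemma eigenvalue_le_rayleigh_bound:
  fixes z :: "nat \<Rightarrow> complex"
  assumes bound: "\<And>y. pairing y (act y) \<le> \<mu> * pairing y y"
    and eig: "\<And>i. i < n \<Longrightarrow> (\<Sum>j<n. of_real (a i j) * z j) = w * z i"
    and "k < n" "z k \<noteq> 0"
  shows "cmod w \<le> \<mu>"
proof -
  let ?y = "\<lambda>j. cmod (z j)"
  have "cmod w * pairing ?y ?y = (\<Sum>i<n. g i * ?y i * (cmod w * ?y i))"
    by (simp add: pairing_def sum_distrib_left mult_ac)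
  also have "\<dots> \<le> pairing ?y (act ?y)"
    unfolding pairing_def
  proof (rule sum_mono)
    fix i assume "i \<in> {..<n}"
    then have "cmod w * ?y i \<le> act ?y i"
      using act_abs_ge[of i z] eig by (simp add: norm_mult)
    then show "g i * ?y i * (cmod w * ?y i) \<le> g i * ?y i * act ?y i"
      using weight_pos \<open>i \<in> {..<n}\<close> by (intro mult_left_mono) (auto simp: less_imp_le)
  qed
  also have "\<dots> \<le> \<mu> * pairing ?y ?y" by (rule bound)
  finally show ?thesis
    using pairing_self_pos[of k ?y] assms(3,4) by simp
qed

text \<open>
  Passing from \<open>x\<close> to \<open>\<bar>x\<bar>\<close> does not increase the form \<open>\<langle>y, y\<rangle> - \<langle>y, N y\<rangle>\<close>, so \<open>\<bar>x\<bar>\<close> is a null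
  vector as well. A nonnegative fixed vector of \<open>N\<close> that vanishes at a vertex vanishes at all its
  neighbours, hence everywhere if the graph is connected.
\<close>

lemma null_vector_nowhere_zero:
  assumes connected: "\<And>i j. i < n \<Longrightarrow> j < n \<Longrightarrow> (\<lambda>i j. i < n \<and> j < n \<and> a i j \<noteq> 0)\<^sup>*\<^sup>* i j"
    and nonneg: "\<And>y. pairing y (act y) \<le> pairing y y"
    and fixed: "\<And>i. i < n \<Longrightarrow> act x i = x i"
    and "k < n" "x k \<noteq> 0" "i < n"
  shows "x i \<noteq> 0"
proof
  assume "x i = 0"
  let ?y = "\<lambda>j. \<bar>x j\<bar>"
  have "pairing ?y ?y = pairing x (act x)"
    using fixed by (auto simp: pairing_def mult.assoc intro!: sum.cong)
  also have "\<dots> \<le> pairing ?y (act ?y)"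
    unfolding pairing_def
  proof (rule sum_mono)
    fix i assume i: "i \<in> {..<n}"
    have "x i * act x i \<le> ?y i * \<bar>act x i\<bar>"
      by (metis abs_ge_self abs_mult)
    also have "\<bar>act x i\<bar> \<le> act ?y i"
      using act_abs_ge[of i "\<lambda>j. of_real (x j)"] i
      by (simp add: act_def flip: of_real_mult of_real_sum)
    finally have "x i * act x i \<le> ?y i * act ?y i" by (simp add: mult_left_mono)
    then show "g i * x i * act x i \<le> g i * ?y i * act ?y i"
      using weight_pos i by (simp add: mult.assoc)
  qed
  finally have att: "pairing ?y (act ?y) \<ge> 1 * pairing ?y ?y" by simp
  have fixed_abs: "act ?y j = ?y j" if "j < n" for j
    using maximizer_is_eigenvector[of 1 ?y j] nonneg att that by simp
  have spread: "x j' = 0" if "x j = 0" "j < n" "j' < n" "a j j' \<noteq> 0" for j j'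
  proof -
    have "(\<Sum>l<n. a j l * ?y l) = 0"
      using fixed_abs[OF \<open>j < n\<close>] that by (simp add: act_def)
    moreover have "\<forall>l\<in>{..<n}. a j l * ?y l \<ge> 0"
      using entry_nonneg \<open>j < n\<close> by simp
    ultimately have "a j j' * ?y j' = 0"
      using \<open>j' < n\<close> by (subst (asm) sum_nonneg_eq_0_iff) auto
    then show ?thesis using that by simp
  qed
  have "(\<lambda>i j. i < n \<and> j < n \<and> a i j \<noteq> 0)\<^sup>*\<^sup>* i k"
    using connected assms by blast
  then have "x k = 0"
    by (induction rule: rtranclp_induct) (use \<open>x i = 0\<close> spread in auto)
  then show False using assms by simp
qed

end

section \<open>From the products of the blocks to the whole matrix\<close>

text \<open>The matrix \<open>N\<close> with \<open>K = 2 I - 2 N\<close>, for \<open>K\<close> with diagonal entries 2.\<close>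

definition half_adjacency :: "int mat \<Rightarrow> nat \<Rightarrow> nat \<Rightarrow> real" where
  "half_adjacency K i j = (if i = j then 0 else - real_of_int (K $$ (i, j)) / 2)"

text \<open>
  An eigenvector \<open>u\<close> of \<open>D F\<close> for \<open>w\<^sup>2\<close> extends to an eigenvector \<open>(u, F u / w)\<close> for \<open>w\<close> of the block
  matrix with off-diagonal blocks \<open>D\<close> and \<open>F\<close>. The right-hand side is symmetric in the two blocks, which gives the
  common nonzero spectrum of \<open>D F\<close> and \<open>F D\<close>.
\<close>

lemma eigenvalue_mult_iff_block:
  fixes D F :: "'a :: field mat"
  assumes D: "D \<in> carrier_mat p q" and F: "F \<in> carrier_mat q p" and "w \<noteq> 0"
  shows "eigenvalue (D * F) (w\<^sup>2) \<longleftrightarrow>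
    (\<exists>u \<in> carrier_vec p. \<exists>v \<in> carrier_vec q.
       D *\<^sub>v v = w \<cdot>\<^sub>v u \<and> F *\<^sub>v u = w \<cdot>\<^sub>v v \<and> (u \<noteq> 0\<^sub>v p \<or> v \<noteq> 0\<^sub>v q))" (is "?L = ?R")
proof
  assume ?L
  then obtain u where u: "u \<in> carrier_vec p" "u \<noteq> 0\<^sub>v p" and eig: "(D * F) *\<^sub>v u = w\<^sup>2 \<cdot>\<^sub>v u"
    using D by (auto simp: eigenvalue_def eigenvector_def)
  define v where "v = (1 / w) \<cdot>\<^sub>v (F *\<^sub>v u)"
  have v: "v \<in> carrier_vec q" using F u by (simp add: v_def)
  have "D *\<^sub>v v = (1 / w) \<cdot>\<^sub>v (D *\<^sub>v (F *\<^sub>v u))"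
    unfolding v_def using D F u by (intro mult_mat_vec) auto
  also have "D *\<^sub>v (F *\<^sub>v u) = w\<^sup>2 \<cdot>\<^sub>v u"
    using assoc_mult_mat_vec[OF D F u(1)] eig by simp
  finally have "D *\<^sub>v v = w \<cdot>\<^sub>v u"
    using \<open>w \<noteq> 0\<close> by (simp add: smult_smult_assoc power2_eq_square)
  moreover have "F *\<^sub>v u = w \<cdot>\<^sub>v v"
    using \<open>w \<noteq> 0\<close> by (simp add: v_def smult_smult_assoc)
  ultimately show ?R using u v by blast
next
  assume ?R
  then obtain u v where u: "u \<in> carrier_vec p" and v: "v \<in> carrier_vec q"
    and Dv: "D *\<^sub>v v = w \<cdot>\<^sub>v u" and Fu: "F *\<^sub>v u = w \<cdot>\<^sub>v v" and nz: "u \<noteq> 0\<^sub>v p \<or> v \<noteq> 0\<^sub>v q"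
    by blast
  have "u \<noteq> 0\<^sub>v p"
  proof
    assume "u = 0\<^sub>v p"
    then have "F *\<^sub>v u = 0\<^sub>v q" using F by (intro eq_vecI) auto
    then have "w \<cdot>\<^sub>v v = 0\<^sub>v q" using Fu by simp
    then have "(1 / w) \<cdot>\<^sub>v (w \<cdot>\<^sub>v v) = (1 / w) \<cdot>\<^sub>v 0\<^sub>v q" by simp
    also have "\<dots> = 0\<^sub>v q" by (intro eq_vecI) auto
    finally have "v = 0\<^sub>v q" using \<open>w \<noteq> 0\<close> by (simp add: smult_smult_assoc)
    with nz \<open>u = 0\<^sub>v p\<close> show False by simp
  qed
  moreover have "(D * F) *\<^sub>v u = w\<^sup>2 \<cdot>\<^sub>v u"
  proof -
    have "(D * F) *\<^sub>v u = D *\<^sub>v (w \<cdot>\<^sub>v v)"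
      using assoc_mult_mat_vec[OF D F u] Fu by simp
    also have "\<dots> = w \<cdot>\<^sub>v (D *\<^sub>v v)" using D v by (rule mult_mat_vec)
    finally show ?thesis using Dv by (simp add: smult_smult_assoc power2_eq_square)
  qed
  ultimately show ?L using u D by (auto simp: eigenvalue_def eigenvector_def)
qed

lemma eigenvalue_mult_commute:
  fixes D F :: "'a :: field mat"
  assumes D: "D \<in> carrier_mat p q" and F: "F \<in> carrier_mat q p" and "w \<noteq> 0"
  shows "eigenvalue (D * F) (w\<^sup>2) \<longleftrightarrow> eigenvalue (F * D) (w\<^sup>2)"
  unfolding eigenvalue_mult_iff_block[OF assms] eigenvalue_mult_iff_block[OF F D \<open>w \<noteq> 0\<close>] by blast

lemma splitting_dim:
  assumes "bipartite_splitting K p q D F"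
  shows "dim_row K = p + q" "dim_col K = p + q"
proof -
  have K: "map_mat real_of_int K =
      four_block_mat (2 \<cdot>\<^sub>m 1\<^sub>m p) (2 \<cdot>\<^sub>m D) (2 \<cdot>\<^sub>m F) (2 \<cdot>\<^sub>m 1\<^sub>m q)"
    using assms by (simp add: bipartite_splitting_def)
  show "dim_row K = p + q" "dim_col K = p + q"
    using arg_cong[OF K, of dim_row] arg_cong[OF K, of dim_col] by simp_all
qed

lemma sum_lessThan_add: "(\<Sum>j<p + q. h j) = (\<Sum>j<p. h j) + (\<Sum>j<q. h (p + j))"
  for h :: "nat \<Rightarrow> 'a :: comm_monoid_add"
  by (induction q) (simp_all add: add.assoc)

lemma half_adjacency_splitting:
  assumes "bipartite_splitting K p q D F"
  shows "i < p \<Longrightarrow> j < p \<Longrightarrow> half_adjacency K i j = 0"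
    and "i < p \<Longrightarrow> j < q \<Longrightarrow> half_adjacency K i (p + j) = - D $$ (i, j)"
    and "i < q \<Longrightarrow> j < p \<Longrightarrow> half_adjacency K (p + i) j = - F $$ (i, j)"
    and "i < q \<Longrightarrow> j < q \<Longrightarrow> half_adjacency K (p + i) (p + j) = 0"
proof -
  have entry: "real_of_int (K $$ (i, j)) =
     four_block_mat (2 \<cdot>\<^sub>m 1\<^sub>m p) (2 \<cdot>\<^sub>m D) (2 \<cdot>\<^sub>m F) (2 \<cdot>\<^sub>m 1\<^sub>m q) $$ (i, j)"
    if "i < p + q" "j < p + q" for i j
    using assms that splitting_dim[OF assms]
    by (metis bipartite_splitting_def index_map_mat(1))
  have "D \<in> carrier_mat p q" "F \<in> carrier_mat q p"
    using assms by (auto simp: bipartite_splitting_def)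
  then show "i < p \<Longrightarrow> j < p \<Longrightarrow> half_adjacency K i j = 0"
    and "i < p \<Longrightarrow> j < q \<Longrightarrow> half_adjacency K i (p + j) = - D $$ (i, j)"
    and "i < q \<Longrightarrow> j < p \<Longrightarrow> half_adjacency K (p + i) j = - F $$ (i, j)"
    and "i < q \<Longrightarrow> j < q \<Longrightarrow> half_adjacency K (p + i) (p + j) = 0"
    by (auto simp: half_adjacency_def entry)
qed

lemma sum_half_adjacency:
  fixes x :: "nat \<Rightarrow> complex"
  assumes "bipartite_splitting K p q D F"
  shows "i < p \<Longrightarrow> (\<Sum>j<p + q. of_real (half_adjacency K i j) * x j) =
      - (\<Sum>j<q. of_real (D $$ (i, j)) * x (p + j))"
    and "i < q \<Longrightarrow> (\<Sum>j<p + q. of_real (half_adjacency K (p + i) j) * x j) =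
      - (\<Sum>j<p. of_real (F $$ (i, j)) * x j)"
  by (simp_all add: sum_lessThan_add half_adjacency_splitting[OF assms] sum_negf)

text \<open>
  \<open>N\<close> carries the blocks with a minus sign. Negating the coordinates of the second class removes it,
  which is why \<open>v\<close> changes sign in both directions of the proof.
\<close>

lemma spectrum_iff_half_adjacency:
  assumes "bipartite_splitting K p q D F" and "w \<noteq> 0"
  shows "w\<^sup>2 \<in> complex_spectrum (D * F) \<longleftrightarrow>
    (\<exists>x. (\<exists>i<p + q. x i \<noteq> 0) \<and>
      (\<forall>i<p + q. (\<Sum>j<p + q. complex_of_real (half_adjacency K i j) * x j) = w * x i))" (is "?L = ?R")
proof -
  let ?c = "map_mat complex_of_real"
  have DF: "D \<in> carrier_mat p q" "F \<in> carrier_mat q p"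
    using assms by (auto simp: bipartite_splitting_def)
  then have DFc: "?c D \<in> carrier_mat p q" "?c F \<in> carrier_mat q p" by auto
  have "w\<^sup>2 \<in> complex_spectrum (D * F) \<longleftrightarrow> eigenvalue (?c D * ?c F) (w\<^sup>2)"
    using DF by (simp add: complex_spectrum_def spectrum_def of_real_hom.mat_hom_mult)
  also have "\<dots> \<longleftrightarrow> (\<exists>u \<in> carrier_vec p. \<exists>v \<in> carrier_vec q.
       ?c D *\<^sub>v v = w \<cdot>\<^sub>v u \<and> ?c F *\<^sub>v u = w \<cdot>\<^sub>v v \<and> (u \<noteq> 0\<^sub>v p \<or> v \<noteq> 0\<^sub>v q))"
    by (rule eigenvalue_mult_iff_block[OF DFc \<open>w \<noteq> 0\<close>])
  also have "\<dots> \<longleftrightarrow> ?R" (is "?M = ?R")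
  proof
    assume ?M
    then obtain u v where u: "u \<in> carrier_vec p" and v: "v \<in> carrier_vec q"
      and Dv: "?c D *\<^sub>v v = w \<cdot>\<^sub>v u" and Fu: "?c F *\<^sub>v u = w \<cdot>\<^sub>v v"
      and nz: "u \<noteq> 0\<^sub>v p \<or> v \<noteq> 0\<^sub>v q"
      by blast
    define x where "x = (\<lambda>i. if i < p then u $ i else - v $ (i - p))"
    have "(\<Sum>j<p + q. of_real (half_adjacency K i j) * x j) = w * x i" if "i < p + q" for i
    proof (cases "i < p")
      case True
      have "(\<Sum>j<q. of_real (D $$ (i, j)) * v $ j) = (?c D *\<^sub>v v) $ i"
        using DF v True by (simp add: scalar_prod_def atLeast0LessThan)
      also have "\<dots> = w * x i"
        unfolding Dv using True u by (simp add: x_def)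
      finally show ?thesis
        unfolding sum_half_adjacency(1)[OF assms(1) True] by (simp add: x_def sum_negf)
    next
      case False
      define i' where "i' = i - p"
      have i': "i = p + i'" "i' < q" using False \<open>i < p + q\<close> by (auto simp: i'_def)
      have "(\<Sum>j<p. of_real (F $$ (i', j)) * u $ j) = (?c F *\<^sub>v u) $ i'"
        using DF u i'(2) by (simp add: scalar_prod_def atLeast0LessThan)
      also have "\<dots> = - (w * x i)"
        unfolding Fu i'(1) using i'(2) v by (simp add: x_def)
      finally show ?thesis
        unfolding i'(1) sum_half_adjacency(2)[OF assms(1) i'(2)] by (simp add: x_def)
    qed
    moreover have "\<exists>i<p + q. x i \<noteq> 0"
    proof (rule ccontr)
      assume "\<not> ?thesis"
      then have zero: "x i = 0" if "i < p + q" for i using that by blast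
      have "u $ j = 0" if "j < p" for j
        using zero[of j] that by (simp add: x_def)
      then have "u = 0\<^sub>v p" using u by (intro eq_vecI) auto
      moreover have "v $ j = 0" if "j < q" for j
        using zero[of "p + j"] that by (simp add: x_def)
      then have "v = 0\<^sub>v q" using v by (intro eq_vecI) auto
      ultimately show False using nz by blast
    qed
    ultimately show ?R by blast
  next
    assume ?R
    then obtain x k where k: "k < p + q" "x k \<noteq> 0"
      and x: "\<And>i. i < p + q \<Longrightarrow> (\<Sum>j<p + q. of_real (half_adjacency K i j) * x j) = w * x i"
      by blast
    define u where "u = vec p x"
    define v where "v = vec q (\<lambda>j. - x (p + j))"
    have "?c D *\<^sub>v v = w \<cdot>\<^sub>v u"
    proof (rule eq_vecI)
      fix i assume "i < dim_vec (w \<cdot>\<^sub>v u)"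
      then have "i < p" by (simp add: u_def)
      then show "(?c D *\<^sub>v v) $ i = (w \<cdot>\<^sub>v u) $ i"
        using x[of i, unfolded sum_half_adjacency(1)[OF assms(1) \<open>i < p\<close>]] DF
        by (simp add: scalar_prod_def atLeast0LessThan u_def v_def sum_negf)
    qed (use DF in \<open>simp add: u_def\<close>)
    moreover have "?c F *\<^sub>v u = w \<cdot>\<^sub>v v"
    proof (rule eq_vecI)
      fix i assume "i < dim_vec (w \<cdot>\<^sub>v v)"
      then have "i < q" by (simp add: v_def)
      have "(?c F *\<^sub>v u) $ i = (\<Sum>j<p. of_real (F $$ (i, j)) * x j)"
        using DF \<open>i < q\<close> by (simp add: scalar_prod_def atLeast0LessThan u_def)
      also have "\<dots> = w * (- x (p + i))"
        using x[of "p + i"] \<open>i < q\<close> unfolding sum_half_adjacency(2)[OF assms(1) \<open>i < q\<close>]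
        by (metis minus_minus mult_minus_right nat_add_left_cancel_less)
      finally show "(?c F *\<^sub>v u) $ i = (w \<cdot>\<^sub>v v) $ i"
        using \<open>i < q\<close> by (simp add: v_def)
    qed (use DF in \<open>simp add: v_def\<close>)
    moreover have "u \<noteq> 0\<^sub>v p \<or> v \<noteq> 0\<^sub>v q"
    proof (cases "k < p")
      case True
      then have "u $ k \<noteq> 0" using k by (simp add: u_def)
      then show ?thesis using True by auto
    next
      case False
      then have "p + (k - p) = k" "k - p < q" using k by auto
      moreover from this have "v $ (k - p) \<noteq> 0" using k by (simp add: v_def)
      ultimately show ?thesis by auto
    qed
    ultimately show ?M by (intro bexI[of _ u] bexI[of _ v]) (auto simp: u_def v_def)
  qed
  finally show ?thesis .
qed

lemma complex_spectrum_mult_commute: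
  assumes "D \<in> carrier_mat p q" "F \<in> carrier_mat q p" "w \<noteq> 0"
  shows "w\<^sup>2 \<in> complex_spectrum (D * F) \<longleftrightarrow> w\<^sup>2 \<in> complex_spectrum (F * D)"
  using assms eigenvalue_mult_commute[of "map_mat complex_of_real D" p q "map_mat complex_of_real F" w]
  by (simp add: complex_spectrum_def spectrum_def of_real_hom.mat_hom_mult)

section \<open>Symmetrized generalized Cartan matrices\<close>

lemma symmetrization_entry:
  assumes "symmetrization K T B" "i < dim_row K" "j < dim_row K"
  shows "real_of_int (K $$ (i, j)) = T $$ (i, i) * B $$ (i, j)"
proof -
  let ?n = "dim_row K"
  have T: "T \<in> carrier_mat ?n ?n" "diagonal_mat T" and B: "B \<in> carrier_mat ?n ?n"
    and K: "map_mat real_of_int K = T * B"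
    using assms by (auto simp: symmetrization_def)
  have "dim_col K = ?n" using arg_cong[OF K, of dim_col] B by simp
  then have "real_of_int (K $$ (i, j)) = (T * B) $$ (i, j)"
    using assms unfolding K[symmetric] by simp
  also have "\<dots> = (\<Sum>k<?n. T $$ (i, k) * B $$ (k, j))"
    using assms T B by (simp add: scalar_prod_def atLeast0LessThan)
  also have "\<dots> = (\<Sum>k<?n. if k = i then T $$ (i, i) * B $$ (i, j) else 0)"
    using T assms by (intro sum.cong) (auto simp: diagonal_mat_def)
  finally show ?thesis using assms by simp
qed

text \<open>From \<open>K = T B\<close>, the matrix \<open>B\<close> is obtained by dividing the rows of \<open>K\<close> by the diagonal of
  \<open>T\<close>; the symmetry of \<open>B\<close> is the balance condition for the weights \<open>1 / T $$ (i, i)\<close>.\<close>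

lemma weighted_graph_half_adjacency:
  assumes "generalized_cartan_matrix K" "symmetrization K T B"
  shows "weighted_graph (dim_row K) (half_adjacency K) (\<lambda>i. 1 / T $$ (i, i))"
proof
  fix i j assume i: "i < dim_row K" and j: "j < dim_row K"
  have pos: "T $$ (k, k) > 0" if "k < dim_row K" for k
    using assms that by (auto simp: symmetrization_def)
  have "B $$ (i, j) = B $$ (j, i)"
    using assms i j unfolding symmetrization_def
    by (metis carrier_matD index_transpose_mat(1))
  then show "1 / T $$ (i, i) * half_adjacency K i j = 1 / T $$ (j, j) * half_adjacency K j i"
    using i j pos[OF i] pos[OF j] symmetrization_entry[OF assms(2)]
    by (simp add: half_adjacency_def)
next
  show "0 \<le> half_adjacency K i j" if "i < dim_row K" "j < dim_row K" for i j
    using assms that by (auto simp: half_adjacency_def generalized_cartan_matrix_def)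
qed (use assms in \<open>auto simp: half_adjacency_def symmetrization_def\<close>)

lemma tits_form_half_adjacency:
  assumes gcm: "generalized_cartan_matrix K" and sym: "symmetrization K T B" and n: "n = dim_row K"
  defines "g \<equiv> \<lambda>i. 1 / T $$ (i, i)"
  shows "tits_form B (vec n x) = 2 * (weighted_graph.pairing n g x x
     - weighted_graph.pairing n g x (weighted_graph.act n (half_adjacency K) x))"
proof -
  interpret weighted_graph n "half_adjacency K" g
    unfolding g_def n by (rule weighted_graph_half_adjacency[OF gcm sym])
  have B: "B \<in> carrier_mat n n" using sym by (simp add: symmetrization_def n)
  have entry: "B $$ (i, j) = g i * (2 * of_bool (i = j) - 2 * half_adjacency K i j)"
    if "i < n" "j < n" for i j
  proof -
    have "T $$ (i, i) > 0" using sym that by (simp add: symmetrization_def n)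
    then have "B $$ (i, j) = g i * real_of_int (K $$ (i, j))"
      using symmetrization_entry[OF sym, of i j] that by (simp add: g_def n)
    moreover have "K $$ (i, i) = 2" using gcm that by (simp add: generalized_cartan_matrix_def n)
    ultimately show ?thesis by (auto simp: half_adjacency_def)
  qed
  have "tits_form B (vec n x) = (\<Sum>i<n. x i * (\<Sum>j<n. B $$ (i, j) * x j))"
    using B by (simp add: tits_form_def scalar_prod_def atLeast0LessThan)
  also have "\<dots> = (\<Sum>i<n. 2 * (g i * x i * x i - g i * x i * act x i))"
  proof (rule sum.cong[OF refl])
    fix i assume "i \<in> {..<n}"
    then have i: "i < n" by simp
    have "(\<Sum>j<n. B $$ (i, j) * x j) = (\<Sum>j<n. (if j = i then 2 * g i * x i else 0) - 2 * g i * (half_adjacency K i j * x j))"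
      by (rule sum.cong) (auto simp: entry i algebra_simps)
    also have "\<dots> = 2 * g i * x i - 2 * g i * act x i"
      using i by (simp add: sum_subtractf act_def sum_distrib_left)
    finally have row: "(\<Sum>j<n. B $$ (i, j) * x j) = 2 * g i * x i - 2 * g i * act x i" .
    show "x i * (\<Sum>j<n. B $$ (i, j) * x j) = 2 * (g i * x i * x i - g i * x i * act x i)"
      unfolding row by (simp add: algebra_simps)
  qed
  finally show ?thesis
    by (simp add: pairing_def sum_subtractf sum_distrib_left)
qed

section \<open>The dominant eigenvalue as a squared Rayleigh quotient\<close>

text \<open>
  Nonzero eigenvalues of \<open>D F\<close> and \<open>F D\<close> are the squares of eigenvalues of \<open>N\<close>. The
  correspondence is silent on the eigenvalue 0, so the case \<open>\<mu> = 0\<close> is settled separately: every eigenvalue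
  has modulus at most 0, and a complex matrix of positive dimension has an eigenvalue.
\<close>

lemma dominant_value_square:
  assumes wg: "weighted_graph n (half_adjacency K) g"
    and split: "bipartite_splitting K p q D F" and n: "n = p + q" "n > 0"
    and bound: "\<And>y. weighted_graph.pairing n g y (weighted_graph.act n (half_adjacency K) y)
       \<le> \<mu> * weighted_graph.pairing n g y y"
    and "\<mu> \<ge> 0" and "k < n" "x k \<noteq> 0"
    and eig: "\<And>i. i < n \<Longrightarrow> weighted_graph.act n (half_adjacency K) x i = \<mu> * x i"
  shows "dominant_value p q D F (\<mu>\<^sup>2)"
proof -
  interpret weighted_graph n "half_adjacency K" g by (rule wg)
  have DF: "D \<in> carrier_mat p q" "F \<in> carrier_mat q p"
    using split by (auto simp: bipartite_splitting_def)
  have upper: "cmod z \<le> \<mu>\<^sup>2" if "z \<in> complex_spectrum (D * F)" for z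
  proof (cases "z = 0")
    case False
    define w where "w = csqrt z"
    have w: "w \<noteq> 0" "z = w\<^sup>2" using False by (simp_all add: w_def)
    have "w\<^sup>2 \<in> complex_spectrum (D * F)" using that by (simp add: w)
    then have "\<exists>y. (\<exists>k<n. y k \<noteq> 0) \<and>
      (\<forall>i<n. (\<Sum>j<n. complex_of_real (half_adjacency K i j) * y j) = w * y i)"
      unfolding spectrum_iff_half_adjacency[OF split w(1)] n(1) .
    then obtain y k where "k < n" "y k \<noteq> 0"
      "\<And>i. i < n \<Longrightarrow> (\<Sum>j<n. complex_of_real (half_adjacency K i j) * y j) = w * y i"
      by blast
    then have "cmod w \<le> \<mu>" by (intro eigenvalue_le_rayleigh_bound[OF bound])
    then show ?thesis by (simp add: w norm_power power_mono)
  qed simp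
  have upper': "cmod z \<le> \<mu>\<^sup>2" if "z \<in> complex_spectrum (F * D)" for z
  proof (cases "z = 0")
    case False
    then show ?thesis
      using that upper complex_spectrum_mult_commute[OF DF, of "csqrt z"] by simp
  qed simp
  have mem: "of_real (\<mu>\<^sup>2) \<in> complex_spectrum (D * F) \<and> of_real (\<mu>\<^sup>2) \<in> complex_spectrum (F * D)"
    if "\<mu> \<noteq> 0"
  proof -
    have "(\<Sum>j<n. complex_of_real (half_adjacency K i j) * complex_of_real (x j)) =
        of_real \<mu> * of_real (x i)" if "i < n" for i
      using arg_cong[OF eig[OF that], of complex_of_real] by (simp add: act_def)
    then have "\<exists>y. (\<exists>k<n. y k \<noteq> 0) \<and>
      (\<forall>i<n. (\<Sum>j<n. complex_of_real (half_adjacency K i j) * y j) = of_real \<mu> * y i)"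
      using \<open>k < n\<close> \<open>x k \<noteq> 0\<close> by (intro exI[of _ "\<lambda>i. complex_of_real (x i)"]) auto
    then have "(of_real \<mu>)\<^sup>2 \<in> complex_spectrum (D * F)"
      using that unfolding n(1) by (subst spectrum_iff_half_adjacency[OF split]) auto
    then show ?thesis
      using complex_spectrum_mult_commute[OF DF, of "of_real \<mu>"] that by simp
  qed
  have "of_real (\<mu>\<^sup>2) \<in> complex_spectrum A"
    if A: "A \<in> carrier_mat m m" "m > 0" "A = D * F \<or> A = F * D" for A m
  proof (cases "\<mu> = 0")
    case True
    have "complex_spectrum A \<noteq> {}"
      unfolding complex_spectrum_def using A by (intro spectrum_non_empty[of _ m]) auto
    then obtain z where "z \<in> complex_spectrum A" by blast
    moreover from this have "cmod z \<le> 0" using A upper[of z] upper'[of z] True by auto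
    ultimately show ?thesis using True by simp
  qed (use mem A in auto)
  from this[of "D * F" p] this[of "F * D" q] show ?thesis
    using DF n upper upper' unfolding dominant_value_def dominant_eigenvalue_def by auto
qed

section \<open>Adding a vertex\<close>

text \<open>Row sums over the large graph split into the new vertex \<open>w\<close> and the old vertices \<open>f i\<close>; the
  vertex \<open>f l\<close> is the neighbour of \<open>w\<close>.\<close>

lemma one_vertex_extensionE:
  assumes "one_vertex_extension K K'" "generalized_cartan_matrix K'"
  obtains f w l where "\<And>i. i < dim_row K \<Longrightarrow> f i < dim_row K' \<and> f i \<noteq> w" "w < dim_row K'"
    "inj_on f {..<dim_row K}"
    "\<And>h :: nat \<Rightarrow> real. (\<Sum>j<dim_row K'. h j) = h w + (\<Sum>i<dim_row K. h (f i))"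
    "\<And>i j. i < dim_row K \<Longrightarrow> j < dim_row K \<Longrightarrow> half_adjacency K' (f i) (f j) = half_adjacency K i j"
    "l < dim_row K" "half_adjacency K' w (f l) \<noteq> 0" "half_adjacency K' (f l) w \<noteq> 0"
    "\<And>i. i < dim_row K \<Longrightarrow> i \<noteq> l \<Longrightarrow> half_adjacency K' w (f i) = 0 \<and> half_adjacency K' (f i) w = 0"
proof -
  obtain f w where w: "w < dim_row K'" and bij: "bij_betw f {..<dim_row K} ({..<dim_row K'} - {w})"
    and emb: "\<And>i j. i < dim_row K \<Longrightarrow> j < dim_row K \<Longrightarrow> K' $$ (f i, f j) = K $$ (i, j)"
    and ex1: "\<exists>!i. i < dim_row K \<and> adjacent K' w (f i)"
    using assms(1) unfolding one_vertex_extension_def by blast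
  obtain l where l: "l < dim_row K" "adjacent K' w (f l)"
    and uniq: "\<And>i. i < dim_row K \<Longrightarrow> adjacent K' w (f i) \<Longrightarrow> i = l"
    using ex1 by blast
  have range: "f i < dim_row K' \<and> f i \<noteq> w" if "i < dim_row K" for i
    using bij_betwE[OF bij] that by auto
  have inj: "inj_on f {..<dim_row K}" using bij by (simp add: bij_betw_def)
  have sym: "K' $$ (i, w) = 0 \<longleftrightarrow> K' $$ (w, i) = 0" if "i < dim_row K'" "i \<noteq> w" for i
    using assms(2) w that by (auto simp: generalized_cartan_matrix_def)
  show ?thesis
  proof (rule that)
    show "(\<Sum>j<dim_row K'. h j) = h w + (\<Sum>i<dim_row K. h (f i))" for h :: "nat \<Rightarrow> real"
      using w sum.remove[of "{..<dim_row K'}" w h] sum.reindex_bij_betw[OF bij, of h] by simp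
    show "half_adjacency K' (f i) (f j) = half_adjacency K i j"
      if "i < dim_row K" "j < dim_row K" for i j
      using that emb inj_onD[OF inj, of i j] by (auto simp: half_adjacency_def)
    show "half_adjacency K' w (f l) \<noteq> 0" "half_adjacency K' (f l) w \<noteq> 0"
      using l range[OF l(1)] sym[of "f l"] by (auto simp: half_adjacency_def adjacent_def)
    show "half_adjacency K' w (f i) = 0 \<and> half_adjacency K' (f i) w = 0"
      if "i < dim_row K" "i \<noteq> l" for i
      using uniq[OF that(1)] that(2) range[OF that(1)] sym[of "f i"] w
      by (auto simp: half_adjacency_def adjacent_def)
  qed (use w range inj l in auto)
qed

lemma adjacent_iff_half_adjacency:
  "adjacent K = (\<lambda>i j. i < dim_row K \<and> j < dim_row K \<and> half_adjacency K i j \<noteq> 0)"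
  by (auto simp: fun_eq_iff adjacent_def half_adjacency_def)

text \<open>
  The form of the extended tree is nondegenerate: a fixed vector \<open>x\<close> of \<open>N'\<close> restricts to a vector \<open>u\<close> on
  the old vertices with \<open>u - N u\<close> concentrated at the neighbour \<open>l\<close> of the new vertex \<open>w\<close>. Since
  \<open>u - N u\<close> is orthogonal to every null vector, and null vectors do not vanish at \<open>l\<close>, it is zero and
  \<open>x w = 0\<close>. Row \<open>w\<close> now gives \<open>u l = 0\<close>, so the null vector \<open>u\<close> is zero.
\<close>

lemma extended_dynkin_extension_no_fixed_vector:
  assumes K: "valued_tree K" and sym: "symmetrization K T B" and ext: "extended_dynkin B"
    and K': "generalized_cartan_matrix K'" and ove: "one_vertex_extension K K'"
    and fixed: "\<And>i. i < dim_row K' \<Longrightarrow> (\<Sum>j<dim_row K'. half_adjacency K' i j * x j) = x i"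
    and "i < dim_row K'"
  shows "x i = 0"
proof -
  define n where "n = dim_row K"
  define g where "g = (\<lambda>i. 1 / T $$ (i, i))"
  have gcm: "generalized_cartan_matrix K" using K by (simp add: valued_tree_def)
  interpret weighted_graph n "half_adjacency K" g
    unfolding g_def n_def by (rule weighted_graph_half_adjacency[OF gcm sym])
  have B: "dim_row B = n" using sym by (auto simp: symmetrization_def n_def)
  note tits = tits_form_half_adjacency[OF gcm sym n_def, folded g_def]
  have nonneg: "pairing y (act y) \<le> pairing y y" for y
  proof -
    have "tits_form B (vec n y) \<ge> 0"
      using ext B unfolding extended_dynkin_def nonnegative_definite_def by auto
    then show ?thesis by (simp add: tits)
  qed
  obtain z k where k: "k < n" "z k \<noteq> 0" and null: "\<And>i. i < n \<Longrightarrow> act z i = z i"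
  proof -
    obtain v where v: "v \<in> carrier_vec n" "v \<noteq> 0\<^sub>v n" "tits_form B v \<le> 0"
      using ext B by (force simp: extended_dynkin_def positive_definite_def)
    have vec: "vec n (($) v) = v" using v by (intro eq_vecI) auto
    have "\<exists>k<n. v $ k \<noteq> 0" using v by (metis carrier_vecD eq_vecI index_zero_vec)
    moreover have "pairing (($) v) (act (($) v)) \<ge> pairing (($) v) (($) v)"
      using v(3) tits[of "($) v"] unfolding vec by simp
    ultimately show ?thesis
      using that maximizer_is_eigenvector[of 1 "($) v"] nonneg by auto
  qed
  have connected: "(\<lambda>i j. i < n \<and> j < n \<and> half_adjacency K i j \<noteq> 0)\<^sup>*\<^sup>* i j" if "i < n" "j < n" for i j
    using K that unfolding valued_tree_def tree_graph_def adjacent_iff_half_adjacency n_def by blast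
  have nowhere_zero: "y i \<noteq> 0"
    if "\<And>i. i < n \<Longrightarrow> act y i = y i" "k < n" "y k \<noteq> 0" "i < n" for y k i
    by (rule null_vector_nowhere_zero[OF connected nonneg that])
  obtain f w l where f: "\<And>i. i < n \<Longrightarrow> f i < dim_row K' \<and> f i \<noteq> w" and w: "w < dim_row K'"
    and inj: "inj_on f {..<n}"
    and sum': "\<And>h :: nat \<Rightarrow> real. (\<Sum>j<dim_row K'. h j) = h w + (\<Sum>i<n. h (f i))"
    and emb: "\<And>i j. i < n \<Longrightarrow> j < n \<Longrightarrow> half_adjacency K' (f i) (f j) = half_adjacency K i j"
    and l: "l < n" "half_adjacency K' w (f l) \<noteq> 0" "half_adjacency K' (f l) w \<noteq> 0"
    and others: "\<And>i. i < n \<Longrightarrow> i \<noteq> l \<Longrightarrow> half_adjacency K' w (f i) = 0 \<and> half_adjacency K' (f i) w = 0"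
    by (fact one_vertex_extensionE[OF ove K', folded n_def])
  define u where "u = (\<lambda>i. x (f i))"
  have old_row: "u i - act u i = of_bool (i = l) * (half_adjacency K' (f l) w * x w)" if "i < n" for i
    using fixed[of "f i"] f[OF that] that others[OF that]
    by (auto simp: sum' emb act_def u_def)
  have "g l * z l * (half_adjacency K' (f l) w * x w) =
      pairing (\<lambda>i. of_bool (i = l)) (\<lambda>i. half_adjacency K' (f l) w * x w * z i)"
    using l(1) by (simp add: pairing_unit)
  also have "\<dots> = pairing z (\<lambda>i. of_bool (i = l) * (half_adjacency K' (f l) w * x w))"
    by (simp add: pairing_def mult_ac)
  also have "\<dots> = pairing z (\<lambda>i. 1 * u i + (- 1) * act u i)"
    using old_row by (intro pairing_cong) auto
  also have "\<dots> = pairing z u - pairing (act z) u"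
    unfolding pairing_linear by (simp add: pairing_act_commute)
  also have "pairing (act z) u = pairing z u"
    using null by (intro pairing_cong) auto
  finally have "g l * z l * (half_adjacency K' (f l) w * x w) = 0" by simp
  moreover have "z l \<noteq> 0" using nowhere_zero[OF null k l(1)] by simp
  ultimately have xw: "x w = 0" using l weight_pos[OF l(1)] by simp
  have "(\<Sum>i<n. half_adjacency K' w (f i) * u i) = (\<Sum>i<n. if i = l then half_adjacency K' w (f l) * u l else 0)"
    using others by (intro sum.cong) auto
  then have "u l = 0"
    using fixed[OF w] xw l by (simp add: sum' u_def)
  have u_fixed: "act u i = u i" if "i < n" for i
    using old_row[OF that] xw by simp
  have u_zero: "u i = 0" if "i < n" for i
    using nowhere_zero[of u i l] u_fixed that l \<open>u l = 0\<close> by blast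
  have "(\<Sum>j<dim_row K'. (x j)\<^sup>2) = 0"
    using u_zero by (simp add: sum' xw u_def)
  then show "x i = 0"
    using \<open>i < dim_row K'\<close> by (simp add: sum_nonneg_eq_0_iff)
qed

section \<open>Behaviour of the dominant eigenvalue\<close>

theorem proposition3p11:
  fixes K K' :: "int mat" and T B D F D' F' :: "real mat" and p q p' q' :: nat
  assumes "valued_tree K" and "valued_tree K'"
    and "one_vertex_extension K K'"
    and "symmetrization K T B"
    and "bipartite_splitting K p q D F"
    and "bipartite_splitting K' p' q' D' F'"
  shows "\<exists>\<phi> \<phi>'. dominant_value p q D F \<phi> \<and> dominant_value p' q' D' F' \<phi>' \<and>
           \<phi>' \<ge> \<phi> \<and>
           (extended_dynkin B \<longrightarrow>
              1 \<notin> complex_spectrum (D' * F') \<and> 1 \<notin> complex_spectrum (F' * D')) \<and>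
           (indefinite B \<longrightarrow> \<phi>' > 1)"
proof -
  define n where "n = dim_row K"
  define n' where "n' = dim_row K'"
  have n: "n = p + q" and n': "n' = p' + q'"
    using splitting_dim[OF assms(5)] splitting_dim[OF assms(6)] by (simp_all add: n_def n'_def)
  have gcm: "generalized_cartan_matrix K" and gcm': "generalized_cartan_matrix K'"
    and pos: "n > 0" "n' > 0"
    using assms(1,2) by (auto simp: valued_tree_def tree_graph_def n_def n'_def lessThan_empty_iff)
  obtain T' B' where sym': "symmetrization K' T' B'" using assms(2) by (auto simp: valued_tree_def)
  define g where "g = (\<lambda>i. 1 / T $$ (i, i))"
  define g' where "g' = (\<lambda>i. 1 / T' $$ (i, i))"
  interpret G: weighted_graph n "half_adjacency K" g
    unfolding g_def n_def by (rule weighted_graph_half_adjacency[OF gcm assms(4)])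
  interpret G': weighted_graph n' "half_adjacency K'" g'
    unfolding g'_def n'_def by (rule weighted_graph_half_adjacency[OF gcm' sym'])
  obtain \<mu> k x where mu: "\<mu> \<ge> 0" "k < n" "x k \<noteq> 0" "\<And>i. i < n \<Longrightarrow> G.act x i = \<mu> * x i"
    "\<And>y. G.pairing y (G.act y) \<le> \<mu> * G.pairing y y"
    by (fact G.dominant_pair_exists[OF pos(1)])
  obtain \<mu>' k' x' where mu': "\<mu>' \<ge> 0" "k' < n'" "x' k' \<noteq> 0" "\<And>i. i < n' \<Longrightarrow> G'.act x' i = \<mu>' * x' i"
    "\<And>y. G'.pairing y (G'.act y) \<le> \<mu>' * G'.pairing y y"
    by (fact G'.dominant_pair_exists[OF pos(2)])
  have dom: "dominant_value p q D F (\<mu>\<^sup>2)"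
    by (rule dominant_value_square[OF G.weighted_graph_axioms assms(5) n pos(1) mu(5,1,2,3,4)])
  have dom': "dominant_value p' q' D' F' (\<mu>'\<^sup>2)"
    by (rule dominant_value_square[OF G'.weighted_graph_axioms assms(6) n' pos(2) mu'(5,1,2,3,4)])
  have "\<mu> \<le> \<mu>'"
  proof -
    obtain f w l where f: "\<And>i. i < n \<Longrightarrow> f i < n' \<and> f i \<noteq> w" and w: "w < n'"
      and inj: "inj_on f {..<n}"
      and sum': "\<And>h :: nat \<Rightarrow> real. (\<Sum>j<n'. h j) = h w + (\<Sum>i<n. h (f i))"
      and emb: "\<And>i j. i < n \<Longrightarrow> j < n \<Longrightarrow> half_adjacency K' (f i) (f j) = half_adjacency K i j"
      and l: "l < n" "half_adjacency K' w (f l) \<noteq> 0" "half_adjacency K' (f l) w \<noteq> 0"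
      and others: "\<And>i. i < n \<Longrightarrow> i \<noteq> l \<Longrightarrow> half_adjacency K' w (f i) = 0 \<and> half_adjacency K' (f i) w = 0"
      by (fact one_vertex_extensionE[OF assms(3) gcm', folded n_def n'_def])
    define y where "y = (\<lambda>j. if j = w then 0 else x (the_inv_into {..<n} f j))"
    have yf: "y (f i) = x i" if "i < n" for i
      using f[OF that] inj that by (simp add: y_def the_inv_into_f_f)
    have yw: "y w = 0" by (simp add: y_def)
    \<comment> \<open>The row of \<open>w\<close> may violate the eigenvector equation, but it does not enter the pairing
      because \<open>y w = 0\<close>.\<close>
    have act: "G'.act y (f i) = \<mu> * x i" if "i < n" for i
      using mu(4)[OF that] that by (simp add: G'.act_def G.act_def sum' yw yf emb)
    have "\<mu> * G'.pairing y y = G'.pairing y (G'.act y)"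
      by (simp add: G'.pairing_def sum' yw yf act sum_distrib_left mult_ac)
    also have "\<dots> \<le> \<mu>' * G'.pairing y y" by (rule mu'(5))
    finally show ?thesis
      using G'.pairing_self_pos[of "f k" y] f(1)[OF mu(2)] yf[OF mu(2)] mu(3) by simp
  qed
  then have "\<mu>\<^sup>2 \<le> \<mu>'\<^sup>2" using mu(1) by (simp add: power_mono)
  have "1 \<notin> complex_spectrum (D' * F')" if "extended_dynkin B"
  proof
    assume "1 \<in> complex_spectrum (D' * F')"
    then obtain z k where k: "k < n'" "z k \<noteq> 0" and fixed:
      "\<And>i. i < n' \<Longrightarrow> (\<Sum>j<n'. complex_of_real (half_adjacency K' i j) * z j) = z i"
      using spectrum_iff_half_adjacency[OF assms(6), of 1] n' by auto
    note zero = extended_dynkin_extension_no_fixed_vector[OF assms(1,4) that gcm' assms(3), folded n'_def]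
    \<comment> \<open>The matrix is real, so the real and imaginary parts of \<open>z\<close> are fixed separately.\<close>
    have "Re (z k) = 0"
      using arg_cong[OF fixed, of _ Re] by (intro zero[of "\<lambda>j. Re (z j)"] k) simp
    moreover have "Im (z k) = 0"
      using arg_cong[OF fixed, of _ Im] by (intro zero[of "\<lambda>j. Im (z j)"] k) simp
    ultimately show False using k by (simp add: complex_eq_iff)
  qed
  moreover have "1 \<in> complex_spectrum (D' * F') \<longleftrightarrow> 1 \<in> complex_spectrum (F' * D')"
    using complex_spectrum_mult_commute[of D' p' q' F' 1] assms(6) by (simp add: bipartite_splitting_def)
  moreover have "\<mu>'\<^sup>2 > 1" if "indefinite B"
  proof -
    have "dim_row B = n" using assms(4) by (auto simp: symmetrization_def n_def)
    with that obtain v where v: "v \<in> carrier_vec n" "tits_form B v < 0"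
      unfolding indefinite_def by metis
    have "vec n (($) v) = v" using v by (intro eq_vecI) auto
    then have "G.pairing (($) v) (($) v) < G.pairing (($) v) (G.act (($) v))"
      using v(2) tits_form_half_adjacency[OF gcm assms(4) n_def, folded g_def, of "($) v"] by simp
    also have "\<dots> \<le> \<mu> * G.pairing (($) v) (($) v)" by (rule mu(5))
    finally have "(\<mu> - 1) * G.pairing (($) v) (($) v) > 0" by (simp add: algebra_simps)
    then have "\<mu> > 1"
      using G.pairing_self_nonneg[of "($) v"] by (simp add: zero_less_mult_iff)
    then show ?thesis using \<open>\<mu> \<le> \<mu>'\<close> by (simp add: one_less_power)
  qed
  ultimately show ?thesis
    using dom dom' \<open>\<mu>\<^sup>2 \<le> \<mu>'\<^sup>2\<close> by blast
qed

end
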